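(* Let $R\in\mathbb{R}^{n\times n}$ be invertible. The max pairing $[\![x,y]\!]_{\infty,R}:=\max_{i\in I_\infty(Ry)}(Rx)_i(Ry)_i$ satisfies Deimling's inequality: for all $x,y\in\mathbb{R}^n$, $$[\![x,y]\!]_{\infty,R}\le\|y\|_{\infty,R}\lim_{h\to0^+}\frac{\|y+hx\|_{\infty,R}-\|y\|_{\infty,R}}{h}.$$
   Context: $\|x\|_{\infty,R}=\|Rx\|_\infty$ and $I_\infty(v)=\{j\in\{1,\dots,n\}:|v_j|=\|v\|_\infty\}$. *)

theory Defs
  imports "HOL-Analysis.Analysis"
begin

definition weighted_infnorm :: "real ^ 'n ^ 'n \<Rightarrow> real ^ 'n \<Rightarrow> real" where
  "weighted_infnorm R x = infnorm (R *v x)"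

definition max_index_set :: "real ^ 'n \<Rightarrow> 'n set" where
  "max_index_set v = {j. \<bar>v $ j\<bar> = infnorm v}"

(* The maximum is over a finite nonempty set, so Max is never applied to a degenerate argument. *)
definition max_pairing :: "real ^ 'n ^ 'n \<Rightarrow> real ^ 'n \<Rightarrow> real ^ 'n \<Rightarrow> real" where
  "max_pairing R x y = Max ((\<lambda>i. (R *v x) $ i * (R *v y) $ i) ` max_index_set (R *v y))"

end

theory Submission
  imports Defs
begin

text \<open>
  With \<open>v = R y\<close> and \<open>w = R x\<close> the claim becomes a statement about the plain max norm along the
  line \<open>h \<mapsto> v + h w\<close>. The norm is convex along this line, so its difference quotients at \<open>0\<close>
  decrease as \<open>h\<close> decreases to \<open>0\<close> and stay above the slope from \<open>-1\<close> to \<open>0\<close>; hence they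
  converge (\<open>convex_on_right_derivative_exists\<close>). For the inequality, take an index \<open>i\<close> at which
  \<open>\<bar>v\<^sub>i\<bar>\<close> is the norm of \<open>v\<close>. For every vector \<open>u\<close> the product of the norms of \<open>v\<close> and \<open>u\<close> is at
  least \<open>v\<^sub>i u\<^sub>i\<close>, with equality when \<open>u = v\<close>. Taking \<open>u = v + h w\<close> and subtracting the equality
  bounds \<open>w\<^sub>i v\<^sub>i\<close> by the norm of \<open>v\<close> times the difference quotient, for every \<open>h > 0\<close>
  (\<open>max_index_product_le_difference_quotient\<close>), and the bound survives the limit. Since it holds
  at every maximizing index, it holds for the largest of the products.
\<close>

lemma max_index_set_nonempty: "max_index_set v \<noteq> {}"
proof -
  have "infnorm v \<in> (\<lambda>b. \<bar>v \<bullet> b\<bar>) ` Basis"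
    unfolding infnorm_Max by (intro Max_in) auto
  then show ?thesis
    by (force simp: max_index_set_def Basis_vec_def inner_axis)
qed

lemma convex_on_infnorm_line: "convex_on UNIV (\<lambda>h. infnorm (v + h *\<^sub>R w))"
proof (rule convex_onI)
  fix t a b :: real
  assume t: "0 < t" "t < 1"
  have "v + ((1 - t) *\<^sub>R a + t *\<^sub>R b) *\<^sub>R w = (1 - t) *\<^sub>R (v + a *\<^sub>R w) + t *\<^sub>R (v + b *\<^sub>R w)"
    by (simp add: algebra_simps)
  then have "infnorm (v + ((1 - t) *\<^sub>R a + t *\<^sub>R b) *\<^sub>R w)
      \<le> infnorm ((1 - t) *\<^sub>R (v + a *\<^sub>R w)) + infnorm (t *\<^sub>R (v + b *\<^sub>R w))"
    by (metis infnorm_triangle)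
  then show "infnorm (v + ((1 - t) *\<^sub>R a + t *\<^sub>R b) *\<^sub>R w)
      \<le> (1 - t) * infnorm (v + a *\<^sub>R w) + t * infnorm (v + b *\<^sub>R w)"
    using t by (simp add: infnorm_mul)
qed simp

text \<open>
  The slopes of a convex function from a fixed point are monotone. To the right of \<open>0\<close> they are
  therefore bounded below by any slope to the left of \<open>0\<close>, and they converge to their infimum.
\<close>

lemma convex_on_right_derivative_exists:
  fixes g :: "real \<Rightarrow> real"
  assumes "convex_on UNIV g"
  shows "\<exists>L. ((\<lambda>h. (g h - g 0) / h) \<longlongrightarrow> L) (at_right 0)"
proof -
  have mono: "(g a - g 0) / a \<le> (g b - g 0) / b" if "0 < a" "a \<le> b" for a b
  proof (cases "a = b")
    case False
    then show ?thesis
      using convex_on_slope_le(1)[OF assms, of 0 b a] that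
      by (simp add: minus_divide_left[symmetric] field_simps)
  qed simp
  have bound: "g 0 - g (-1) \<le> (g a - g 0) / a" if "0 < a" for a
    using convex_on_slope_le[OF assms, of "-1" a 0] that by (simp add: field_simps)
  show ?thesis
    using Lim_right_bound[of UNIV 0 "\<lambda>h. (g h - g 0) / h", OF mono bound] by auto
qed

text \<open>
  Up to the factor \<open>h\<close>, this compares \<open>\<parallel>v\<parallel> \<parallel>v + h w\<parallel> \<ge> v\<^sub>i (v\<^sub>i + h w\<^sub>i)\<close> with
  \<open>\<parallel>v\<parallel>\<^sup>2 = v\<^sub>i\<^sup>2\<close>; the second holds because \<open>i\<close> is a maximizing index.
\<close>

lemma max_index_product_le_difference_quotient:
  fixes v w :: "real ^ 'n"
  assumes i: "i \<in> max_index_set v" and h: "h > 0"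
  shows "w $ i * v $ i \<le> infnorm v * ((infnorm (v + h *\<^sub>R w) - infnorm v) / h)"
proof -
  have eq: "\<bar>v $ i\<bar> = infnorm v"
    using i by (simp add: max_index_set_def)
  have "v $ i * (v $ i + h * w $ i) \<le> \<bar>v $ i\<bar> * \<bar>(v + h *\<^sub>R w) $ i\<bar>"
    by (metis abs_ge_self abs_mult real_scaleR_def vector_add_component vector_scaleR_component)
  also have "\<dots> \<le> infnorm v * infnorm (v + h *\<^sub>R w)"
    unfolding eq by (intro mult_left_mono component_le_infnorm_cart infnorm_pos_le)
  finally have "v $ i * (v $ i + h * w $ i) \<le> infnorm v * infnorm (v + h *\<^sub>R w)" .
  moreover have "v $ i * v $ i = infnorm v * infnorm v"
    by (metis eq abs_mult_self_eq)
  ultimately show ?thesis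
    using h by (simp add: field_simps)
qed

theorem lemma24:
  fixes R :: "real ^ 'n ^ 'n" and x y :: "real ^ 'n"
  assumes "invertible R"
  shows "\<exists>L. ((\<lambda>h. (weighted_infnorm R (y + h *\<^sub>R x) - weighted_infnorm R y) / h) \<longlongrightarrow> L) (at_right 0)
           \<and> max_pairing R x y \<le> weighted_infnorm R y * L"
proof -
  define v where "v = R *v y"
  define w where "w = R *v x"
  have line: "weighted_infnorm R (y + h *\<^sub>R x) = infnorm (v + h *\<^sub>R w)" for h
    by (simp add: weighted_infnorm_def v_def w_def matrix_vector_right_distrib
        matrix_vector_mult_scaleR)
  have norm_y: "weighted_infnorm R y = infnorm v"
    by (simp add: weighted_infnorm_def v_def)
  obtain L where L: "((\<lambda>h. (infnorm (v + h *\<^sub>R w) - infnorm v) / h) \<longlongrightarrow> L) (at_right 0)"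
    using convex_on_right_derivative_exists[OF convex_on_infnorm_line[of v w]] by auto
  have "w $ i * v $ i \<le> infnorm v * L" if "i \<in> max_index_set v" for i
  proof (rule tendsto_lowerbound[OF tendsto_mult_left[OF L]])
    show "\<forall>\<^sub>F h in at_right 0.
        w $ i * v $ i \<le> infnorm v * ((infnorm (v + h *\<^sub>R w) - infnorm v) / h)"
      using max_index_product_le_difference_quotient[OF that]
      by (auto simp: eventually_at_filter)
  qed simp
  then have "max_pairing R x y \<le> infnorm v * L"
    by (simp add: max_pairing_def max_index_set_nonempty flip: v_def w_def)
  with L show ?thesis
    unfolding line norm_y by blast
qed

end
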